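(* Let $p_1,p_2,p_3\in\{3,4,5,\dots\}\cup\{\infty\}$, let $(C_1,C_2,C_3)$ be a complex hyperbolic $(p_1,p_2,p_3)$-triangle with angular invariant $\alpha$, and let $\iota_1,\iota_2,\iota_3\in \mathrm{SU}(2,1)$ be the complex reflections in its sides. Let $a=(a_1,\dots,a_n)$ be a cyclic word with letters in $\{1,2,3\}$, let $\iota_a=\iota_{a_1}\cdots\iota_{a_n}$ be the corresponding element of the $(p_1,p_2,p_3)$-triangle group, and let $\tau_a$ be the trace of $\iota_a$. Then $$\tau_a=(-1)^n\cdot\left(2+\sum_{S\subset[n]}(-2)^{|S|}\cdot r_1^{u_1(S)}r_2^{u_2(S)}r_3^{u_3(S)}\cdot e^{i\alpha w(S)}\right),$$ where the sum is over all subsets $S$ of $[n]$ (including the empty one). Equivalently, $\tau_a=(-1)^n\cdot(2+p_a(e^{i\alpha}))$, where $p_a(z)=\sum_{w\in\mathbb Z}q_w z^w$ is the Laurent polynomial with coefficients $$q_w=\sum_{S\subset[n],\ w(S)=w}(-2)^{|S|}\cdot r_1^{u_1(S)}r_2^{u_2(S)}r_3^{u_3(S)}.$$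
   Context: $\mathbb C^{2,1}$ is $\mathbb C^3$ with the Hermitian form $\langle z,w\rangle=z_1\bar w_1+z_2\bar w_2-z_3\bar w_3$. The complex hyperbolic plane $H^2_{\mathbb C}$ is the projectivisation of the set of vectors with $\langle z,z\rangle<0$; its ideal boundary is the projectivisation of the set of nonzero null vectors. A complex geodesic $C$ is the projectivisation (intersected with $H^2_{\mathbb C}$) of the orthogonal complement of a vector $c$ with $\langle c,c\rangle>0$; $c$ is called a polar vector of $C$, normalised if $\langle c,c\rangle=1$. Two complex geodesics with normalised polar vectors $c,c'$ meet in $H^2_{\mathbb C}$ at angle $\varphi\in(0,\pi/2]$ iff $|\langle c,c'\rangle|=\cos\varphi<1$; distinct complex geodesics have closures meeting in one point of the ideal boundary ("angle $0$") iff $|\langle c,c'\rangle|=1$. A complex hyperbolic triangle is a triple $(C_1,C_2,C_3)$ of complex geodesics; $c_k$ denotes a normalised polar vector of $C_k$ and $r_k=|\langle c_{k-1},c_{k+1}\rangle|$. All indices are mod 3. It is a $(p_1,p_2,p_3)$-triangle if $C_{k-1}$ and $C_{k+1}$ meet at angle $\pi/p_k$ for each $k$ (with $\pi/\infty=0$), so that $r_k=\cos(\pi/p_k)$. The angular invariant is $\alpha=\arg\left(\prod_{k=1}^3\langle c_{k-1},c_{k+1}\rangle\right)$ (mod $2\pi$). The complex reflection in $C_k$ is represented by $\iota_k\in\mathrm{SU}(2,1)$, $\iota_k(z)=-z+2\langle z,c_k\rangle c_k$, and the $(p_1,p_2,p_3)$-triangle group is the group generated by $\iota_1,\iota_2,\iota_3$.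 A cyclic word is the orbit of a finite sequence under cyclic permutations (the trace $\tau_a$ does not change under cyclic permutations of $a$). The empty word corresponds to the identity. Combinatorial functions of words $b=(b_1,\dots,b_m)$ in the letters $1,2,3$, with $b_{m+1}:=b_1$: let $\chi(x)\in\{-1,0,1\}$ be the integer congruent to $x$ modulo $3$; the winding number is $w(b)=\frac13\sum_{j=1}^m\chi(b_{j+1}-b_j)$; and $u_k(b)=|\{j\in\{1,\dots,m\}: \{b_j,b_{j+1}\}=\{k-1,k+1\}\}|$ (with $k\pm1$ taken mod 3 in $\{1,2,3\}$). For the empty word all these are $0$. For the word $a=(a_1,\dots,a_n)$ and $S=\{i_1<\dots<i_m\}\subset[n]:=\{1,\dots,n\}$, $u_k(S)$ and $w(S)$ denote the values of $u_k$ and $w$ on the subsequence $(a_{i_1},\dots,a_{i_m})$. *)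

theory Defs
  imports
    "HOL-Analysis.Analysis"
    "HOL-Library.Extended_Nat"
    "HOL-Library.Real_Mod"
begin

(* Indices and letters are elements of the three-element ring 3 = {1, 2, 3}, in which 3 = 0;
   so k - 1 and k + 1 are automatically taken modulo 3. *)

section \<open>The complex hyperbolic plane\<close>

definition hform :: "complex^3 \<Rightarrow> complex^3 \<Rightarrow> complex" where
  "hform z w = z$1 * cnj (w$1) + z$2 * cnj (w$2) - z$3 * cnj (w$3)"

lemma hform_self:
  "hform z z = of_real ((cmod (z$1))\<^sup>2 + (cmod (z$2))\<^sup>2 - (cmod (z$3))\<^sup>2)"
  by (simp add: hform_def complex_norm_square [symmetric])

definition SU21 :: "(complex^3^3) set" where
  "SU21 = {A. det A = 1 \<and> (\<forall>z w. hform (A *v z) (A *v w) = hform z w)}"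

(* A point of the complex projective plane is represented by the complex line it stands for. *)
definition proj :: "complex^3 \<Rightarrow> (complex^3) set" where
  "proj z = vec.span {z}"

definition ch_plane :: "(complex^3) set set" where
  "ch_plane = {proj z | z. Re (hform z z) < 0}"

definition ideal_boundary :: "(complex^3) set set" where
  "ideal_boundary = {proj z | z. z \<noteq> 0 \<and> hform z z = 0}"

(* Closure in the quotient topology of the projective plane: the projection from the nonzero
   vectors is open, so taking closures commutes with taking preimages, and the preimage of A is
   the union of the lines in A without 0. *)
definition proj_closure :: "(complex^3) set set \<Rightarrow> (complex^3) set set" where
  "proj_closure A = {proj z | z. z \<noteq> 0 \<and> z \<in> closure (\<Union>A)}"

definition polar_vector :: "complex^3 \<Rightarrow> (complex^3) set set \<Rightarrow> bool" where
  "polar_vector c C \<longleftrightarrow> Re (hform c c) > 0 \<and>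
     C = ch_plane \<inter> {proj z | z. hform z c = 0}"

definition normalised_polar_vector :: "complex^3 \<Rightarrow> (complex^3) set set \<Rightarrow> bool" where
  "normalised_polar_vector c C \<longleftrightarrow> polar_vector c C \<and> hform c c = 1"

definition complex_geodesic :: "(complex^3) set set \<Rightarrow> bool" where
  "complex_geodesic C \<longleftrightarrow> (\<exists>c. polar_vector c C)"

section \<open>Triangles\<close>

definition asymptotic :: "(complex^3) set set \<Rightarrow> (complex^3) set set \<Rightarrow> bool" where
  "asymptotic C C' \<longleftrightarrow> C \<noteq> C' \<and>
     (\<exists>P\<in>ideal_boundary. proj_closure C \<inter> proj_closure C' = {P})"

(* Normalised polar vectors are unique up to a unit scalar, so the choice of c and c' does not
   matter. *)
definition meet_at_angle :: "(complex^3) set set \<Rightarrow> (complex^3) set set \<Rightarrow> real \<Rightarrow> bool" where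
  "meet_at_angle C C' \<phi> \<longleftrightarrow>
     (if \<phi> = 0 then asymptotic C C'
      else 0 < \<phi> \<and> \<phi> \<le> pi / 2 \<and> C \<inter> C' \<noteq> {} \<and>
        (\<exists>c c'. normalised_polar_vector c C \<and> normalised_polar_vector c' C' \<and>
           cmod (hform c c') = cos \<phi>))"

definition pi_over :: "enat \<Rightarrow> real" where
  "pi_over p = (case p of enat n \<Rightarrow> pi / real n | \<infinity> \<Rightarrow> 0)"

definition hyperbolic_triangle :: "(3 \<Rightarrow> enat) \<Rightarrow> (3 \<Rightarrow> (complex^3) set set) \<Rightarrow> bool" where
  "hyperbolic_triangle p C \<longleftrightarrow>
     (\<forall>k. complex_geodesic (C k)) \<and>
     (\<forall>k. meet_at_angle (C (k - 1)) (C (k + 1)) (pi_over (p k)))"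

definition r_par :: "(3 \<Rightarrow> complex^3) \<Rightarrow> 3 \<Rightarrow> real" where
  "r_par c k = cmod (hform (c (k - 1)) (c (k + 1)))"

definition angular_invariant :: "(3 \<Rightarrow> complex^3) \<Rightarrow> real" where
  "angular_invariant c = Arg (\<Prod>k\<in>UNIV. hform (c (k - 1)) (c (k + 1)))"

section \<open>Complex reflections\<close>

definition iota :: "complex^3 \<Rightarrow> complex^3^3" where
  "iota c = matrix (\<lambda>z. - z + (2 * hform z c) *s c)"

definition iota_word :: "(3 \<Rightarrow> complex^3) \<Rightarrow> 3 list \<Rightarrow> complex^3^3" where
  "iota_word c a = foldr (\<lambda>k A. iota (c k) ** A) a (mat 1)"

lemma iota_mult_vec: "iota c *v z = - z + (2 * hform z c) *s c"
  unfolding iota_def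
proof (rule matrix_works)
  show "Vector_Spaces.linear (*s) (*s) (\<lambda>z. - z + (2 * hform z c) *s c)"
    by unfold_locales (simp_all add: hform_def vec_eq_iff algebra_simps)
qed

lemma hform_simps:
  "hform (x + y) z = hform x z + hform y z"  "hform x (y + z) = hform x y + hform x z"
  "hform (x - y) z = hform x z - hform y z"  "hform x (y - z) = hform x y - hform x z"
  "hform (- x) y = - hform x y"  "hform x (- y) = - hform x y"
  "hform (s *s x) y = s * hform x y"  "hform x (s *s y) = cnj s * hform x y"
  by (simp_all add: hform_def algebra_simps)

lemma cnj_hform: "cnj (hform x y) = hform y x"
  by (simp add: hform_def algebra_simps)

lemma iota_in_SU21:
  assumes "hform c c = 1"
  shows "iota c \<in> SU21"
proof -
  have "hform (iota c *v z) (iota c *v w) = hform z w" for z w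
    using assms by (simp add: iota_mult_vec hform_simps cnj_hform algebra_simps)
  moreover have "det (iota c) = 2 * hform c c - 1"
    by (simp add: det_3 iota_def matrix_def hform_def axis_def) algebra
  ultimately show ?thesis
    using assms by (simp add: SU21_def)
qed

lemma iota_word_append: "iota_word c (a @ b) = iota_word c a ** iota_word c b"
  by (induction a) (simp_all add: iota_word_def matrix_mul_assoc)

(* The trace depends only on the cyclic word represented by the list. *)
lemma trace_iota_word_rotate: "trace (iota_word c (rotate k a)) = trace (iota_word c a)"
proof -
  let ?m = "k mod length a"
  have "trace (iota_word c (drop ?m a @ take ?m a)) = trace (iota_word c (take ?m a @ drop ?m a))"
    unfolding iota_word_append by (rule trace_mul_sym)
  then show ?thesis
    by (simp add: rotate_drop_take)
qed

section \<open>Combinatorial functions of words\<close>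

definition chi :: "3 \<Rightarrow> int" where
  "chi x = (if x = 0 then 0 else if x = 1 then 1 else -1)"

lemma of_int_chi: "of_int (chi x) = x"
  using exhaust_3 [of x] by (auto simp: chi_def)

(* With 0-based positions j, the cyclic successor of b ! j is b ! (Suc j mod length b). *)
definition winding :: "3 list \<Rightarrow> int" where
  "winding b = (\<Sum>j<length b. chi (b ! (Suc j mod length b) - b ! j)) div 3"

definition u_count :: "3 \<Rightarrow> 3 list \<Rightarrow> nat" where
  "u_count k b = card {j. j < length b \<and> {b ! j, b ! (Suc j mod length b)} = {k - 1, k + 1}}"

lemma winding_exact:
  "3 * winding b = (\<Sum>j<length b. chi (b ! (Suc j mod length b) - b ! j))" (is "_ = ?s")
proof -
  have chi_diff: "3 dvd chi (x - y) - (chi x - chi y)" for x y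
    using exhaust_3 [of x] exhaust_3 [of y] by (auto simp: chi_def)
  let ?d = "\<lambda>j. chi (b ! (Suc j mod length b)) - chi (b ! j)"
  have "(\<Sum>j<length b. ?d j) = 0"
  proof (cases "length b")
    case (Suc n)
    have "(\<Sum>j<Suc n. chi (b ! (Suc j mod Suc n))) =
        (\<Sum>j<n. chi (b ! Suc j)) + chi (b ! 0)"
      by simp
    also have "\<dots> = (\<Sum>j<Suc n. chi (b ! j))"
      by (subst sum.lessThan_Suc_shift) simp
    finally show ?thesis
      by (simp only: Suc sum_subtractf diff_self)
  qed simp
  moreover have "3 dvd ?s - (\<Sum>j<length b. ?d j)"
    unfolding sum_subtractf [symmetric] by (intro dvd_sum chi_diff)
  ultimately show ?thesis
    by (simp add: winding_def)
qed

(* nths a S is the subsequence of a at the (0-based) positions in S. *)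
definition q_coeff :: "(3 \<Rightarrow> real) \<Rightarrow> 3 list \<Rightarrow> int \<Rightarrow> real" where
  "q_coeff r a w = (\<Sum>S | S \<subseteq> {..<length a} \<and> winding (nths a S) = w.
     (-2) ^ card S * (r 1 ^ u_count 1 (nths a S) * r 2 ^ u_count 2 (nths a S) *
       r 3 ^ u_count 3 (nths a S)))"

lemma finite_q_coeff_support: "finite {w. q_coeff r a w \<noteq> 0}"
proof (rule finite_subset)
  show "{w. q_coeff r a w \<noteq> 0} \<subseteq> (\<lambda>S. winding (nths a S)) ` Pow {..<length a}"
  proof
    fix w assume "w \<in> {w. q_coeff r a w \<noteq> 0}"
    then have "{S. S \<subseteq> {..<length a} \<and> winding (nths a S) = w} \<noteq> {}"
      unfolding q_coeff_def by (metis (mono_tags) mem_Collect_eq sum.empty)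
    then show "w \<in> (\<lambda>S. winding (nths a S)) ` Pow {..<length a}"
      by blast
  qed
qed simp

(* The Laurent polynomial with coefficients q_coeff r a, as a function of z. *)
definition p_laurent :: "(3 \<Rightarrow> real) \<Rightarrow> 3 list \<Rightarrow> complex \<Rightarrow> complex" where
  "p_laurent r a z = (\<Sum>w | q_coeff r a w \<noteq> 0. of_real (q_coeff r a w) * z powi w)"

end

theory Submission
  imports Defs
begin

text \<open>
  Write the reflection in \<open>C\<^sub>k\<close> as \<open>- (1 - 2 P\<^sub>k)\<close> with \<open>P\<^sub>k z = \<langle>z, c\<^sub>k\<rangle> c\<^sub>k\<close> and expand the product of
  the factors \<open>1 - 2 P\<^sub>k\<close>: the subset \<open>S\<close> contributes the trace of a composition of rank one maps,
  which is the cyclic product of the numbers \<open>\<langle>c\<^sub>y, c\<^sub>x\<rangle>\<close> over consecutive letters \<open>x, y\<close>.  The empty set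
  contributes 3, which explains the summand 2.  No \<open>r\<^sub>k\<close> vanishes, so up to unit factors \<open>s\<^sub>k\<close> attached
  to the \<open>c\<^sub>k\<close> all three products \<open>\<langle>c\<^sub>y, c\<^sub>x\<rangle>\<close> with \<open>y = x + 1\<close> have the argument \<open>\<alpha> / 3\<close>.  The \<open>s\<^sub>k\<close>
  cancel in a cyclic product, whose argument is therefore \<open>\<alpha> / 3\<close> times the sum of the \<open>\<chi> (y - x)\<close>,
  that is, \<open>\<alpha>\<close> times the winding number.
\<close>

section \<open>Expansion of the trace\<close>

definition proj_word :: "(3 \<Rightarrow> complex^3) \<Rightarrow> 3 list \<Rightarrow> complex^3 \<Rightarrow> complex^3" where
  "proj_word c b z = foldr (\<lambda>k v. hform v (c k) *s c k) b z"

lemma proj_word_simps [simp]: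
  "proj_word c [] z = z"
  "proj_word c (k # b) z = hform (proj_word c b z) (c k) *s c k"
  by (simp_all add: proj_word_def)

lemma hform_sum_left: "hform (\<Sum>i\<in>A. f i) w = (\<Sum>i\<in>A. hform (f i) w)"
  by (simp add: hform_def sum_distrib_right sum.distrib sum_subtractf)

text \<open>Prepares induction on a word: a new first letter takes position 0 and shifts the old
  positions by \<open>Suc\<close>, and a subset either avoids 0 or contains it.\<close>

lemma sum_Pow_lessThan_Suc:
  fixes f :: "nat set \<Rightarrow> 'a::comm_monoid_add"
  shows "(\<Sum>S\<in>Pow {..<Suc n}. f S) =
    (\<Sum>S\<in>Pow {..<n}. f (Suc ` S)) + (\<Sum>S\<in>Pow {..<n}. f (insert 0 (Suc ` S)))"
proof -
  have inj: "inj_on ((`) Suc) (Pow {..<n})"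
    by (simp add: inj_on_image_Pow)
  have "Pow {..<Suc n} = (`) Suc ` Pow {..<n} \<union> insert 0 ` (`) Suc ` Pow {..<n}"
    by (simp only: lessThan_Suc_eq_insert_0 Pow_insert image_Pow_surj)
  moreover have "inj_on (insert 0) ((`) Suc ` Pow {..<n})"
    by (auto simp: inj_on_def)
  moreover have "(`) Suc ` Pow {..<n} \<inter> insert 0 ` (`) Suc ` Pow {..<n} = {}"
    by auto
  ultimately show ?thesis
    by (simp add: sum.union_disjoint sum.reindex inj)
qed

lemma nths_Cons_image_Suc:
  "nths (x # xs) (Suc ` S) = nths xs S"
  "nths (x # xs) (insert 0 (Suc ` S)) = x # nths xs S"
  by (simp_all add: nths_Cons image_iff)

text \<open>A new first letter \<open>k\<close> multiplies by -(1 - 2 P) with P the map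
  \<open>v\<close> to \<open>hform v (c k) *s c k\<close>: the 1 yields the subsets avoiding
  position 0, the -2 P those containing it.\<close>

lemma iota_word_mult_vec:
  "iota_word c a *v z =
    (-1) ^ length a *s (\<Sum>S\<in>Pow {..<length a}. (-2) ^ card S *s proj_word c (nths a S) z)"
proof (induction a)
  case Nil
  show ?case by (simp add: iota_word_def)
next
  case (Cons k a)
  let ?g = "\<lambda>S. proj_word c (nths a S) z"
  have card: "card (Suc ` S) = card S" "card (insert 0 (Suc ` S)) = Suc (card S)"
    if "S \<in> Pow {..<length a}" for S
    using that by (auto simp: card_image card_insert_if finite_subset)
  have "iota_word c (k # a) *v z = iota (c k) *v (iota_word c a *v z)"
    by (simp add: iota_word_def matrix_vector_mul_assoc)
  also have "\<dots> = (-1) ^ length (k # a) *s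
      ((\<Sum>S\<in>Pow {..<length a}. (-2) ^ card S *s ?g S) +
       (\<Sum>S\<in>Pow {..<length a}. (-2) ^ Suc (card S) *s (hform (?g S) (c k) *s c k)))"
    unfolding Cons.IH iota_mult_vec hform_simps hform_sum_left
    by (simp add: vec_eq_iff sum_distrib_left sum_distrib_right sum_negf algebra_simps)
  also have "\<dots> = (-1) ^ length (k # a) *s
      (\<Sum>S\<in>Pow {..<length (k # a)}. (-2) ^ card S *s proj_word c (nths (k # a) S) z)"
    by (simp add: sum_Pow_lessThan_Suc nths_Cons_image_Suc card)
  finally show ?case .
qed

text \<open>Each rank one map passes on only a scalar. The last letter pairs with \<open>z\<close>;
  each earlier one pairs with its successor's vector.\<close>

lemma proj_word_Cons_eq:
  "proj_word c (k # b) z = (hform z (c ((k # b) ! length b)) *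
    (\<Prod>j<length b. hform (c ((k # b) ! Suc j)) (c ((k # b) ! j)))) *s c k"
proof (induction b arbitrary: k)
  case Nil
  show ?case by simp
next
  case (Cons l b)
  show ?case
    unfolding proj_word_simps(2) [of c k "l # b"] Cons.IH hform_simps
    by (simp add: prod.lessThan_Suc_shift mult_ac vec_eq_iff del: prod.lessThan_Suc)
qed

text \<open>The trace of a rank one map; it supplies the factor that joins the last letter back to
  the first.\<close>

lemma sum_axis_hform: "(\<Sum>i\<in>UNIV. (hform (axis i 1) w *s v) $ i) = hform v w"
  by (simp add: sum_3 hform_def axis_def)

text \<open>For the empty word the identity has trace 3 but the empty product is 1; the correction
  is 2.\<close>

lemma trace_proj_word:
  "(\<Sum>i\<in>UNIV. proj_word c b (axis i 1) $ i) =
    (if b = [] then 2 else 0) + (\<Prod>j<length b. hform (c (b ! (Suc j mod length b))) (c (b ! j)))"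
proof (cases b)
  case Nil
  then show ?thesis by (simp add: sum_3 axis_def)
next
  case (Cons k b')
  let ?h = "\<lambda>j. hform (c (b ! Suc j)) (c (b ! j))"
  have "(\<Sum>i\<in>UNIV. proj_word c b (axis i 1) $ i) =
      (\<Sum>i\<in>UNIV. (hform (axis i 1) (c (b ! length b')) *s c k) $ i) * (\<Prod>j<length b'. ?h j)"
    unfolding Cons proj_word_Cons_eq by (simp add: sum_distrib_left sum_distrib_right mult_ac)
  also have "\<dots> = hform (c k) (c (b ! length b')) * (\<Prod>j<length b'. ?h j)"
    by (simp only: sum_axis_hform)
  also have "\<dots> = (\<Prod>j<Suc (length b'). hform (c (b ! (Suc j mod Suc (length b')))) (c (b ! j)))"
    by (simp add: Cons mult.commute)
  finally show ?thesis by (simp add: Cons)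
qed

lemma trace_conv_axis: "trace (A :: complex^3^3) = (\<Sum>i\<in>UNIV. (A *v axis i 1) $ i)"
  by (simp add: trace_def matrix_vector_mul_component sum_3 axis_def inner_vec_def
      matrix_vector_mult_def)

lemma trace_iota_word:
  "trace (iota_word c a) = (-1) ^ length a * (2 + (\<Sum>S\<in>Pow {..<length a}. (-2) ^ card S *
    (\<Prod>j<length (nths a S). hform (c (nths a S ! (Suc j mod length (nths a S)))) (c (nths a S ! j)))))"
  (is "_ = _ * (2 + (\<Sum>S\<in>_. _ * ?h S))")
proof -
  have empty: "nths a S = [] \<longleftrightarrow> S = {}" if "S \<in> Pow {..<length a}" for S
    using that by (auto simp: set_nths simp flip: set_empty)
  have "trace (iota_word c a) = (-1) ^ length a * (\<Sum>S\<in>Pow {..<length a}. (-2) ^ card S *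
      (\<Sum>i\<in>UNIV. proj_word c (nths a S) (axis i 1) $ i))"
    unfolding trace_conv_axis iota_word_mult_vec
    by (simp add: sum_distrib_left sum.swap [of _ "Pow {..<length a}"])
  also have "(\<Sum>S\<in>Pow {..<length a}. (-2) ^ card S *
      (\<Sum>i\<in>UNIV. proj_word c (nths a S) (axis i 1) $ i)) =
      (\<Sum>S\<in>Pow {..<length a}. (if S = {} then 2 else 0) + (-2) ^ card S * ?h S)"
    by (intro sum.cong refl) (simp add: trace_proj_word empty algebra_simps)
  also have "\<dots> = 2 + (\<Sum>S\<in>Pow {..<length a}. (-2) ^ card S * ?h S)"
    by (simp add: sum.distrib)
  finally show ?thesis .
qed

section \<open>Moduli and arguments\<close>

lemma cyclic_prod_shift:
  fixes f :: "nat \<Rightarrow> 'a::comm_monoid_mult"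
  shows "(\<Prod>j<n. f (Suc j mod n)) = (\<Prod>j<n. f j)"
proof (cases n)
  case (Suc m)
  have "(\<Prod>j<Suc m. f (Suc j mod Suc m)) = (\<Prod>j<m. f (Suc j)) * f 0"
    by simp
  also have "\<dots> = (\<Prod>j<Suc m. f j)"
    by (subst prod.lessThan_Suc_shift) (simp add: mult.commute)
  finally show ?thesis by (simp add: Suc)
qed simp

lemma prod_UNIV_3: "(\<Prod>k\<in>UNIV. f k) = f 1 * f 2 * f (3 :: 3)"
  unfolding UNIV_3 by (simp add: mult.assoc)

text \<open>The phases of the three forward products multiply to \<open>\<zeta> ^ 3\<close>. Divided
  by \<open>\<zeta>\<close> they multiply to 1 around the triangle, so they are quotients
  \<open>s (x + 1) / s x\<close>. Reversing a pair conjugates, which inverts \<open>\<zeta>\<close>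
  and the quotient.\<close>

lemma hform_rescale:
  assumes norm: "\<And>k. hform (c k) (c k) = 1"
    and nz: "\<And>k. r_par c k \<noteq> 0"
    and \<zeta>: "cmod \<zeta> = 1" "\<zeta> ^ 3 = cis (angular_invariant c)"
  obtains s :: "3 \<Rightarrow> complex" where "\<And>k. s k \<noteq> 0"
    and "\<And>x y. hform (c y) (c x) =
      of_real (\<Prod>k\<in>UNIV. if {x, y} = {k - 1, k + 1} then r_par c k else 1) *
      \<zeta> powi chi (y - x) * (s y / s x)"
proof -
  define u where "u x = sgn (hform (c (x + 1)) (c x))" for x
  \<comment> \<open>Zero is written as 3, so that rewriting with these equations keeps the vertex
    names 1, 2, 3.\<close>
  have num: "(1::3) - 1 = 3" "(1::3) + 1 = 2" "(2::3) - 1 = 1" "(2::3) + 1 = 3"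
    "(3::3) - 1 = 2" "(3::3) + 1 = 1"
    by simp_all
  have r: "r_par c 1 = cmod (hform (c 3) (c 2))" "r_par c 2 = cmod (hform (c 1) (c 3))"
    "r_par c 3 = cmod (hform (c 2) (c 1))"
    by (simp_all only: r_par_def num)
  have h_nz: "hform (c 3) (c 2) \<noteq> 0" "hform (c 1) (c 3) \<noteq> 0" "hform (c 2) (c 1) \<noteq> 0"
    using nz [of 1] nz [of 2] nz [of 3] by (simp_all add: r)
  have forward: "hform (c (x + 1)) (c x) = of_real (cmod (hform (c (x + 1)) (c x))) * u x" for x
    by (cases "hform (c (x + 1)) (c x) = 0") (simp_all add: u_def sgn_div_norm scaleR_conv_of_real)
  have u: "u 1 = sgn (hform (c 2) (c 1))" "u 2 = sgn (hform (c 3) (c 2))"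
    "u 3 = sgn (hform (c 1) (c 3))"
    by (simp_all only: u_def num)
  have u3: "u 1 * u 2 * u 3 = \<zeta> ^ 3"
  proof -
    let ?P = "hform (c 3) (c 2) * hform (c 1) (c 3) * hform (c 2) (c 1)"
    have "(\<Prod>k\<in>UNIV. hform (c (k - 1)) (c (k + 1))) = ?P"
      by (simp only: prod_UNIV_3 num)
    then have "\<zeta> ^ 3 = sgn ?P"
      using h_nz by (simp add: \<zeta> angular_invariant_def cis_Arg)
    then show ?thesis by (simp only: u sgn_mult mult_ac)
  qed
  have nu: "cmod (u x) = 1" for x
    using exhaust_3 [of x] h_nz by (auto simp: u norm_sgn)
  have \<zeta>_nz: "\<zeta> \<noteq> 0" using \<zeta> by auto
  have u_nz: "u x \<noteq> 0" for x using nu [of x] by auto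
  \<comment> \<open>Start from \<open>s 1 = 1\<close> and solve
    \<open>s (x + 1) = s x * u x / \<zeta>\<close>; the step from 3 back to 1 is consistent by
    \<open>u3\<close>.\<close>
  define s where "s k = (if k = 1 then 1 else if k = 2 then u 1 / \<zeta> else u 1 * u 2 / \<zeta>\<^sup>2)" for k :: 3
  have s_norm: "cmod (s k) = 1" for k
    by (simp add: s_def nu norm_divide norm_mult norm_power \<zeta>)
  then have s_nz: "s k \<noteq> 0" for k by (metis norm_zero zero_neq_one)
  have s_step: "u x = \<zeta> * (s (x + 1) / s x)" for x
  proof -
    have s_simps: "s 1 = 1" "s 2 = u 1 / \<zeta>" "s 3 = u 1 * u 2 / \<zeta>\<^sup>2"
      by (simp_all add: s_def)
    consider "x = 1" | "x = 2" | "x = 3" using exhaust_3 [of x] by blast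
    then show ?thesis
    proof cases
      case 1
      then show ?thesis by (simp only: num s_simps) (simp add: \<zeta>_nz)
    next
      case 2
      then show ?thesis
        by (simp only: num s_simps) (simp add: \<zeta>_nz u_nz field_simps power2_eq_square)
    next
      case 3
      then show ?thesis using u3
        by (simp only: num s_simps)
          (simp add: \<zeta>_nz u_nz field_simps power2_eq_square power3_eq_cube)
    qed
  qed
  \<comment> \<open>For distinct \<open>x\<close>, \<open>y\<close> only the third index contributes
    a factor; for \<open>x = y\<close> none does.\<close>
  define m where "m x y = (\<Prod>k\<in>UNIV. if {x, y} = {k - 1, k + 1} then r_par c k else 1)" for x y
  have m_commute: "m x y = m y x" for x y
    by (simp add: m_def insert_commute)
  have distinct: "(1::3) \<noteq> 2" "(1::3) \<noteq> 3" "(2::3) \<noteq> 3"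
    by simp_all
  have m_diag: "m x x = 1" for x
    using exhaust_3 [of x] distinct distinct [symmetric]
    by (elim disjE) (simp_all only: m_def prod_UNIV_3 num doubleton_eq_iff, simp_all)
  have m_step: "m x (x + 1) = cmod (hform (c (x + 1)) (c x))" for x
    using exhaust_3 [of x] distinct distinct [symmetric]
    by (elim disjE) (simp_all only: m_def prod_UNIV_3 num doubleton_eq_iff r, simp_all)
  have forward_scaled: "hform (c (x + 1)) (c x) = of_real (m x (x + 1)) * \<zeta> * (s (x + 1) / s x)" for x
    by (subst forward, subst s_step, subst m_step) simp
  have cnj_unit: "cnj z = inverse z" if "cmod z = 1" for z
    using that by (metis complex_norm_square inverse_unique of_real_1 one_power2)
  have backward_scaled: "hform (c x) (c (x + 1)) = of_real (m (x + 1) x) * inverse \<zeta> * (s x / s (x + 1))" for x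
  proof -
    have "hform (c x) (c (x + 1)) = cnj (hform (c (x + 1)) (c x))"
      by (simp add: cnj_hform)
    also have "\<dots> = of_real (m x (x + 1)) * inverse \<zeta> * (inverse (s (x + 1)) / inverse (s x))"
      by (subst forward_scaled) (simp only: complex_cnj_mult complex_cnj_divide complex_cnj_complex_of_real
          cnj_unit \<zeta> s_norm)
    finally show ?thesis
      by (simp add: m_commute [of x] divide_inverse mult_ac)
  qed
  have "hform (c y) (c x) = of_real (m x y) * \<zeta> powi chi (y - x) * (s y / s x)" for x y
  proof -
    consider "y = x" | "y = x + 1" | "x = y + 1"
      using exhaust_3 [of x] exhaust_3 [of y] by auto
    then show ?thesis
    proof cases
      case 1
      then show ?thesis by (simp only: m_diag) (simp add: norm s_nz chi_def)
    next
      case 2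
      then show ?thesis by (simp only: forward_scaled) (simp add: chi_def)
    next
      case 3
      have "chi (y - (y + 1)) = -1" using exhaust_3 [of y] by (auto simp: chi_def)
      with 3 show ?thesis by (simp only: backward_scaled) (simp add: power_int_minus)
    qed
  qed
  with s_nz show thesis unfolding m_def by (rule that)
qed

lemma prod_if_const_eq_power:
  fixes r :: "'a::comm_monoid_mult"
  assumes "finite A"
  shows "(\<Prod>j\<in>A. if P j then r else 1) = r ^ card {j \<in> A. P j}"
  using assms by (simp add: prod.If_cases Int_def)

lemma cyclic_prod_hform:
  assumes norm: "\<And>k. hform (c k) (c k) = 1"
    and nz: "\<And>k. r_par c k \<noteq> 0"
    and \<alpha>: "exp (\<i> * of_real \<alpha>) = cis (angular_invariant c)"
  shows "(\<Prod>j<length b. hform (c (b ! (Suc j mod length b))) (c (b ! j))) =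
    of_real (r_par c 1 ^ u_count 1 b * r_par c 2 ^ u_count 2 b * r_par c 3 ^ u_count 3 b) *
    exp (\<i> * of_real \<alpha> * of_int (winding b))"
proof -
  \<comment> \<open>Any unit cube root would serve: the exponents add up to a multiple of 3.\<close>
  define \<zeta> where "\<zeta> = cis (\<alpha> / 3)"
  have "\<zeta> ^ 3 = cis (real 3 * (\<alpha> / 3))"
    unfolding \<zeta>_def by (rule Complex.DeMoivre)
  also have "\<dots> = cis (angular_invariant c)"
    using \<alpha> by (simp add: cis_conv_exp)
  finally have \<zeta>: "cmod \<zeta> = 1" "\<zeta> ^ 3 = cis (angular_invariant c)"
    by (simp_all add: \<zeta>_def)
  have [simp]: "\<zeta> \<noteq> 0" by (simp add: \<zeta>_def)
  obtain s where s_nz: "\<And>k. s k \<noteq> 0"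
    and s: "\<And>x y. hform (c y) (c x) =
      of_real (\<Prod>k\<in>UNIV. if {x, y} = {k - 1, k + 1} then r_par c k else 1) *
      \<zeta> powi chi (y - x) * (s y / s x)"
    by (rule hform_rescale [OF norm nz \<zeta>]) blast
  let ?n = "length b" and ?y = "\<lambda>j. b ! (Suc j mod length b)"
  have "(\<Prod>j<?n. \<Prod>k\<in>UNIV. if {b ! j, ?y j} = {k - 1, k + 1} then r_par c k else 1) =
      (\<Prod>k\<in>UNIV. r_par c k ^ u_count k b)"
    by (subst prod.swap) (simp add: prod_if_const_eq_power u_count_def)
  moreover have "(\<Prod>j<?n. \<zeta> powi chi (?y j - b ! j)) = exp (\<i> * of_real \<alpha> * of_int (winding b))"
  proof -
    have "(\<Prod>j<?n. \<zeta> powi chi (?y j - b ! j)) = \<zeta> powi (\<Sum>j<?n. chi (?y j - b ! j))"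
      by (induction rule: infinite_finite_induct) (simp_all add: power_int_add)
    also have "\<dots> = \<zeta> powi (3 * winding b)"
      by (simp only: winding_exact)
    also have "\<dots> = (\<zeta> ^ 3) powi winding b"
      by (simp add: power_int_mult)
    also have "\<dots> = exp (\<i> * of_real \<alpha>) powi winding b"
      by (simp add: \<zeta> \<alpha>)
    finally show ?thesis
      by (simp add: exp_power_int mult.commute)
  qed
  \<comment> \<open>Numerators and denominators run over the same letters, shifted
    cyclically.\<close>
  moreover have "(\<Prod>j<?n. s (?y j) / s (b ! j)) = 1"
    by (simp add: prod_dividef s_nz cyclic_prod_shift [of "\<lambda>j. s (b ! j)"])
  ultimately show ?thesis
    by (simp only: s prod.distrib of_real_prod [symmetric] prod_UNIV_3 mult_1_right)
qed

section \<open>Nonvanishing of the products of polar vectors\<close>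

text \<open>The witness is the cross product adapted to the form; its square norm is minus the Gram
  determinant of \<open>c\<close> and \<open>d\<close>.\<close>

lemma orthonormal_imp_negative_orthogonal:
  assumes "hform c c = 1" "hform d d = 1" "hform c d = 0"
  obtains z where "hform z z = -1" "hform z c = 0" "hform z d = 0"
proof
  let ?z = "vector [cnj (c$2 * d$3 - c$3 * d$2), cnj (c$3 * d$1 - c$1 * d$3),
    - cnj (c$1 * d$2 - c$2 * d$1)] :: complex^3"
  show "hform ?z c = 0" "hform ?z d = 0"
    by (simp_all add: hform_def algebra_simps)
  have "hform d c = 0"
    using assms(3) cnj_hform by (metis complex_cnj_zero)
  have "hform ?z ?z = hform c d * hform d c - hform c c * hform d d"
    by (simp add: hform_def algebra_simps)
  then show "hform ?z ?z = -1" using assms by simp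
qed

text \<open>Otherwise a negative vector orthogonal to both gives a common point of the geodesics. It
  would be the single ideal point of their closures, yet its line contains no nonzero null
  vector.\<close>

lemma asymptotic_imp_hform_nonzero:
  assumes "asymptotic C D" "normalised_polar_vector c C" "normalised_polar_vector d D"
  shows "hform c d \<noteq> 0"
proof
  assume "hform c d = 0"
  with assms obtain z where z: "hform z z = -1" "hform z c = 0" "hform z d = 0"
    by (meson normalised_polar_vector_def orthonormal_imp_negative_orthogonal)
  have z_nz: "z \<noteq> 0" using z(1) by (auto simp: hform_def)
  have in_closure: "proj z \<in> proj_closure E" if "normalised_polar_vector e E" "hform z e = 0" for e E
  proof -
    have "proj z \<in> E"
      using that z(1) by (auto simp: normalised_polar_vector_def polar_vector_def ch_plane_def)
    moreover have "z \<in> proj z" by (simp add: proj_def vec.span_base)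
    ultimately have "z \<in> closure (\<Union>E)" by (intro subsetD [OF closure_subset] UnionI)
    with z_nz show ?thesis unfolding proj_closure_def by blast
  qed
  with assms(2,3) z have "proj z \<in> proj_closure C \<inter> proj_closure D" by blast
  then have "proj z \<in> ideal_boundary"
    using assms(1) unfolding asymptotic_def by (metis singletonD)
  then obtain v where v: "v \<noteq> 0" "hform v v = 0" "proj z = proj v"
    by (auto simp: ideal_boundary_def)
  then have "v \<in> proj z" by (simp add: proj_def vec.span_base)
  then obtain t where "v = t *s z" by (auto simp: proj_def vec.span_singleton)
  with v z(1) show False by (auto simp: hform_simps)
qed

section \<open>Normalised polar vectors of one geodesic agree up to a scalar\<close>

lemma mem_geodesic_imp_orthogonal:
  assumes "polar_vector c C" "proj z \<in> C"
  shows "hform z c = 0"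
proof -
  obtain v where v: "proj z = proj v" "hform v c = 0"
    using assms by (auto simp: polar_vector_def)
  then have "z \<in> proj v" by (metis proj_def singletonI vec.span_base)
  then obtain t where "z = t *s v" by (auto simp: proj_def vec.span_singleton)
  with v show ?thesis by (simp add: hform_simps)
qed

lemma hform_nondegenerate:
  assumes "\<And>v. hform v w = 0"
  shows "w = 0"
  using assms [of "axis 1 1"] assms [of "axis 2 1"] assms [of "axis 3 1"]
  by (simp add: hform_def axis_def vec_eq_iff forall_3)

text \<open>The negative vectors in the orthogonal complement of a polar vector span it, because adding a
  large multiple of a negative vector makes any vector negative.\<close>

lemma normalised_polar_vector_unique:
  assumes c: "normalised_polar_vector c C" and d: "normalised_polar_vector d C"
  shows "d = hform d c *s c"
proof -
  have cc: "hform c c = 1" using c by (simp add: normalised_polar_vector_def)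
  define e :: "complex^3" where "e = axis 3 1"
  \<comment> \<open>Removing from a negative vector its component along the positive
    \<open>c\<close> keeps it negative.\<close>
  define z where "z = e - hform e c *s c"
  have zc: "hform z c = 0" by (simp add: z_def hform_simps cc)
  have "hform e e = -1" by (simp add: e_def hform_def axis_def)
  then have "hform z z = - 1 - hform e c * hform c e"
    by (simp add: z_def hform_simps cnj_hform cc)
  also have "\<dots> = of_real (- 1 - (cmod (hform e c))\<^sup>2)"
    using complex_norm_square [of "hform e c"] by (simp add: cnj_hform)
  finally have zz: "Re (hform z z) \<le> -1" by simp
  have neg: "hform v d = 0" if "hform v c = 0" "Re (hform v v) < 0" for v
  proof -
    have "proj v \<in> C"
      using c that by (auto simp: normalised_polar_vector_def polar_vector_def ch_plane_def)
    then show ?thesis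
      using d by (auto simp: normalised_polar_vector_def intro: mem_geodesic_imp_orthogonal)
  qed
  have sub: "hform y d = 0" if y: "hform y c = 0" for y
  proof -
    define B E where "B = \<bar>Re (hform z y)\<bar>" and "E = \<bar>Re (hform y y)\<bar>"
    \<comment> \<open>Chosen so that -N^2 + 2 N B + E collapses to E - N (E + 1), which is negative
      as 1 \<le> N.\<close>
    define N where "N = 2 * B + E + 1"
    have BE: "0 \<le> B" "0 \<le> E" by (simp_all add: B_def E_def)
    have N: "1 \<le> N" using BE by (simp add: N_def)
    let ?v = "of_real N *s z + y"
    have "Re (hform y z) = Re (hform z y)"
      by (simp flip: cnj_hform [of z y])
    then have "Re (hform ?v ?v) = N\<^sup>2 * Re (hform z z) + 2 * (N * Re (hform z y)) + Re (hform y y)"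
      by (simp add: hform_simps power2_eq_square algebra_simps)
    also have "\<dots> \<le> N\<^sup>2 * (-1) + 2 * (N * B) + E"
      using N zz by (intro add_mono mult_left_mono) (auto simp: B_def E_def)
    also have "\<dots> = E - N * (E + 1)"
      by (simp add: N_def power2_eq_square algebra_simps)
    also have "\<dots> < 0"
      using mult_right_mono [OF N, of "E + 1"] BE by (smt (verit))
    finally have "hform ?v d = 0"
      by (intro neg) (simp_all add: hform_simps zc y)
    moreover have "hform z d = 0" using zz zc by (intro neg) auto
    ultimately show ?thesis by (simp add: hform_simps)
  qed
  \<comment> \<open>Pairing \<open>v\<close> with this difference equals pairing the part of
    \<open>v\<close> orthogonal to \<open>c\<close> with \<open>d\<close>.\<close>
  have "hform v (d - hform d c *s c) = 0" for v
    using sub [of "v - hform v c *s c"]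
    by (simp add: hform_simps cnj_hform cc)
  then have "d - hform d c *s c = 0" by (rule hform_nondegenerate)
  then show ?thesis by simp
qed

text \<open>A positive angle provides some polar vectors with product of modulus
  \<open>cos \<phi>\<close> > 0; uniqueness up to scalars carries this over to \<open>c\<close> and
  \<open>d\<close>. Angle 0 is the asymptotic case.\<close>

lemma meet_at_angle_imp_hform_nonzero:
  assumes "meet_at_angle C D \<phi>" "\<phi> < pi / 2"
    and c: "normalised_polar_vector c C" and d: "normalised_polar_vector d D"
  shows "hform c d \<noteq> 0"
proof (cases "\<phi> = 0")
  case True
  then show ?thesis
    using assms by (auto simp: meet_at_angle_def dest: asymptotic_imp_hform_nonzero)
next
  case False
  then obtain c' d' where c': "normalised_polar_vector c' C" and d': "normalised_polar_vector d' D"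
    and cos: "cmod (hform c' d') = cos \<phi>" and "0 < \<phi>"
    using assms(1) by (auto simp: meet_at_angle_def)
  with assms(2) have "hform c' d' \<noteq> 0"
    using cos_gt_zero [of \<phi>] by auto
  moreover have "hform c' d' = hform c' c * cnj (hform d' d) * hform c d"
    by (subst normalised_polar_vector_unique [OF c c'], subst normalised_polar_vector_unique [OF d d'])
      (simp add: hform_simps mult_ac)
  ultimately show ?thesis by auto
qed

text \<open>Excludes right angles, at which the product of polar vectors vanishes and has no
  phase.\<close>

lemma pi_over_less:
  assumes "3 \<le> p"
  shows "pi_over p < pi / 2"
proof (cases p)
  case (enat n)
  with assms have "3 \<le> n" by (simp add: numeral_eq_enat)
  then show ?thesis
    unfolding enat by (simp add: pi_over_def field_simps)
qed (simp add: pi_over_def)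

section \<open>Sorting the subsets by winding number\<close>

lemma p_laurent_eq_sum:
  "p_laurent r a z = (\<Sum>S\<in>Pow {..<length a}. (-2) ^ card S *
    of_real (r 1 ^ u_count 1 (nths a S) * r 2 ^ u_count 2 (nths a S) * r 3 ^ u_count 3 (nths a S)) *
    z powi winding (nths a S))"
proof -
  let ?A = "Pow {..<length a}" and ?w = "\<lambda>S. winding (nths a S)"
  let ?t = "\<lambda>S. (-2) ^ card S *
    (r 1 ^ u_count 1 (nths a S) * r 2 ^ u_count 2 (nths a S) * r 3 ^ u_count 3 (nths a S))"
  have q: "q_coeff r a w = (\<Sum>S | S \<in> ?A \<and> ?w S = w. ?t S)" for w
    by (simp add: q_coeff_def)
  have "{w. q_coeff r a w \<noteq> 0} \<subseteq> ?w ` ?A"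
  proof
    fix w assume "w \<in> {w. q_coeff r a w \<noteq> 0}"
    then have "{S. S \<in> ?A \<and> ?w S = w} \<noteq> {}"
      unfolding q by (metis (mono_tags) mem_Collect_eq sum.empty)
    then show "w \<in> ?w ` ?A" by blast
  qed
  \<comment> \<open>Windings that are attained but whose terms cancel may be added, since their
    coefficient is 0.\<close>
  then have "p_laurent r a z = (\<Sum>w\<in>?w ` ?A. of_real (q_coeff r a w) * z powi w)"
    unfolding p_laurent_def by (intro sum.mono_neutral_left) auto
  also have "\<dots> = (\<Sum>w\<in>?w ` ?A. \<Sum>S | S \<in> ?A \<and> ?w S = w. of_real (?t S) * z powi ?w S)"
    unfolding q of_real_sum sum_distrib_right by (intro sum.cong refl) simp
  also have "\<dots> = (\<Sum>S\<in>?A. of_real (?t S) * z powi ?w S)"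
    by (rule sum.group) auto
  finally show ?thesis by simp
qed

theorem theorem4:
  fixes p :: "3 \<Rightarrow> enat"
    and C :: "3 \<Rightarrow> (complex^3) set set"
    and c :: "3 \<Rightarrow> complex^3"
    and \<alpha> :: real
    and a :: "3 list"
  assumes "\<And>k. 3 \<le> p k"
    and "hyperbolic_triangle p C"
    and "\<And>k. normalised_polar_vector (c k) (C k)"
    and "[\<alpha> = angular_invariant c] (rmod (2 * pi))"
  shows "trace (iota_word c a) = (-1) ^ length a *
      (2 + (\<Sum>S\<in>Pow {..<length a}. (-2) ^ card S *
        of_real (r_par c 1 ^ u_count 1 (nths a S) * r_par c 2 ^ u_count 2 (nths a S) *
          r_par c 3 ^ u_count 3 (nths a S)) *
        exp (\<i> * of_real \<alpha> * of_int (winding (nths a S)))))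
    \<and> trace (iota_word c a) = (-1) ^ length a *
      (2 + p_laurent (r_par c) a (exp (\<i> * of_real \<alpha>)))"
proof -
  have norm: "hform (c k) (c k) = 1" for k
    using assms(3) by (simp add: normalised_polar_vector_def)
  have nz: "r_par c k \<noteq> 0" for k
  proof -
    have "meet_at_angle (C (k - 1)) (C (k + 1)) (pi_over (p k))"
      using assms(2) by (simp add: hyperbolic_triangle_def)
    then have "hform (c (k - 1)) (c (k + 1)) \<noteq> 0"
      by (rule meet_at_angle_imp_hform_nonzero [OF _ pi_over_less [OF assms(1)] assms(3) assms(3)])
    then show ?thesis by (simp add: r_par_def)
  qed
  \<comment> \<open>Only this exponential of \<alpha> enters, so a congruence modulo 2
    \<open>pi\<close> suffices.\<close>
  have \<alpha>: "exp (\<i> * of_real \<alpha>) = cis (angular_invariant c)"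
    using cis_cong [OF assms(4)] by (simp add: cis_conv_exp)
  have powi: "exp (\<i> * of_real \<alpha>) powi n = exp (\<i> * of_real \<alpha> * of_int n)" for n
    by (simp add: exp_power_int mult.commute)
  show ?thesis
    unfolding p_laurent_eq_sum powi trace_iota_word cyclic_prod_hform [OF norm nz \<alpha>]
    by (simp only: mult.assoc)
qed

end
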